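(* Let $T$ be an invertible self-adjoint ($T=T^*$) block TBT-matrix, and let $u_p,\widehat u_p,J_p$ $(p=1,2)$, $G_{12}$, $G_{21}$, $\mathcal L_1,\mathcal L_2$ be as in the context. Then $$u_p(\mu)=\widehat u_p(\overline\mu)^*J_p\qquad(p=1,2;\ \overline\mu=(\overline{\mu_1},\overline{\mu_2}))$$ for all $\mu=(\mu_1,\mu_2)\in\mathbb C^2$ with $\mu_1,\mu_2\ne-\mathrm i/2$. Moreover, $$G_{21}=-J_2\left(G_{12}^*-\mathrm i\begin{bmatrix}\mathcal L_1\mathcal L_2^*&0 \\ 0&-\mathcal L_1\mathcal L_2^*\end{bmatrix}\right)J_1 .$$
   Context: Notation: $I_r$ is the $r\times r$ identity, $I=I_m$; $\otimes$ is the Kronecker product; ${}^*$ is the conjugate transpose; $\mathrm{col}[\dots]$ stacks blocks into a (block) column; $\mathbf 1_r$ is the $r\times1$ column of ones. Fix integers $m_1,m_2,m_3\ge2$ and put $m=m_1m_2m_3$. A block TBT-matrix is an $m\times m$ matrix $T=\{\mathcal T_{i-k}\}_{i,k=1}^{m_1}$, where $\mathcal T_r=\{t^{(r)}_{i-k}\}_{i,k=1}^{m_2}$ and the $t^{(r)}_s$ are complex $m_3\times m_3$ blocks. Let $$J_1=\begin{bmatrix}0&I_{m_2m_3} \\ I_{m_2m_3}&0\end{bmatrix},\qquad J_2=\begin{bmatrix}0&I_{m_1m_3} \\ I_{m_1m_3}&0\end{bmatrix}.$$ Let $\mathcal A_p=\{a_{j-\ell}\}_{j,\ell=1}^{m_p}$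 with $a_r=0$ for $r<0$, $a_0=\mathrm i/2$, $a_r=\mathrm i$ for $r>0$, and $A_1=\mathcal A_1\otimes I_{m_2}\otimes I_{m_3}$, $A_2=I_{m_1}\otimes\mathcal A_2\otimes I_{m_3}$ (these commute). Let $\mathcal L=\mathbf 1_{m_1m_2}\otimes I_{m_3}$ and $\mathcal L_p=\mathbf 1_{m_p}\otimes I_{m_3}$ $(p=1,2)$. Define $M_{11}=\mathrm{col}[M_{11}^{(1)},\dots,M_{11}^{(m_1)}]$, $M_{11}^{(i)}=\tfrac12\mathcal T_0+\sum_{s=1}^{i-1}\mathcal T_s$; $M_{21}=\mathbf 1_{m_1}^*\otimes I_{m_2m_3}$; $M_{31}=M_{21}^*$; $M_{41}=[M_{41}^{(1)}\ \dots\ M_{41}^{(m_1)}]$, $M_{41}^{(k)}=\tfrac12\mathcal T_0+\sum_{s=1}^{k-1}\mathcal T_{-s}$; $M_{12}=\{M_{12}^{(i-k)}\}_{i,k=1}^{m_1}$, where $M_{12}^{(r)}$ is the block column with $i$-th block $\tfrac12t_0^{(r)}+\sum_{j=1}^{i-1}t_j^{(r)}$ $(1\le i\le m_2)$; $M_{22}=I_{m_1}\otimes\mathbf 1_{m_2}^*\otimes I_{m_3}$; $M_{32}=M_{22}^*$; $M_{42}=\{M_{42}^{(i-k)}\}_{i,k=1}^{m_1}$, where $M_{42}^{(r)}$ is the block row with $k$-th block $\tfrac12t_0^{(r)}+\sum_{\ell=1}^{k-1}t_{-\ell}^{(r)}$ $(1\le k\le m_2)$. For invertible $T$ and $p=1,2$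 put $R=T^{-1}$, $\Pi_p=[M_{1p}\ M_{3p}]$, $\widehat\Pi_p=\begin{bmatrix}M_{2p} \\ M_{4p}\end{bmatrix}$, $\Gamma_p=R\Pi_p$, $\widehat\Gamma_p=\widehat\Pi_pR$. Define $$v_p(\mu)=\mathcal L^*\Big(\prod_{i=1}^2(A_i^*-\mu_iI)^{-1}\Big)\Gamma_p,\qquad \widehat v_p(\lambda)=\widehat\Gamma_p\Big(\prod_{i=1}^2(A_i-\lambda_iI)^{-1}\Big)\mathcal L,$$ and, for $\{k,p\}=\{1,2\}$, $$u_p(\mu)=v_p(\mu)-\mathrm i\big(\mathbf 1_{m_k}^*(\mathcal A_k^*-\mu_kI_{m_k})^{-1}\otimes I_{m_3}\big)\begin{bmatrix}I_{m_km_3}&0\end{bmatrix},$$ $$\widehat u_p(\lambda)=\widehat v_p(\lambda)+\mathrm i\begin{bmatrix}0 \\ I_{m_km_3}\end{bmatrix}\big((\mathcal A_k-\lambda_kI_{m_k})^{-1}\mathbf 1_{m_k}\otimes I_{m_3}\big),$$ where the zero blocks are square of order $m_km_3$. Define further $K_{11}$ = block column with $i$-th block $\tfrac12M_{42}^{(0)}+\sum_{j=1}^{i-1}M_{42}^{(j)}$ $(1\le i\le m_1)$; $K_{12}$ = block row with $k$-th block $\tfrac12M_{12}^{(0)}+\sum_{j=1}^{k-1}M_{12}^{(-j)}$ $(1\le k\le m_1)$; $$G_{21}=\mathrm i\left(\widehat\Pi_2\Gamma_1-\begin{bmatrix}\mathcal L_1\mathcal L_2^*&0 \\ K_{11}&0\end{bmatrix}\right),\qquad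 G_{12}=\mathrm i\left(\widehat\Pi_1\Gamma_2-\begin{bmatrix}\mathcal L_2\mathcal L_1^*&0 \\ K_{12}&0\end{bmatrix}\right).$$ These are the constant off-diagonal blocks of the matrix function $G(\lambda)=\begin{bmatrix}G_{11}(\lambda_2)&G_{12} \\ G_{21}&G_{22}(\lambda_1)\end{bmatrix}$ whose diagonal blocks are $G_{11}(\lambda_2)=I_2\otimes(\mathcal A_2-\lambda_2I_{m_2})\otimes I_{m_3}$ and $G_{22}(\lambda_1)=I_2\otimes(\mathcal A_1-\lambda_1I_{m_1})\otimes I_{m_3}$. *)

theory Defs
  imports "Jordan_Normal_Form.Schur_Decomposition" "Jordan_Normal_Form.Gauss_Jordan_Elimination"
begin

definition kron :: "complex mat \<Rightarrow> complex mat \<Rightarrow> complex mat" (infixl \<open>\<otimes>\<^sub>K\<close> 72) where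
  "A \<otimes>\<^sub>K B = mat (dim_row A * dim_row B) (dim_col A * dim_col B)
     (\<lambda>(i, j). A $$ (i div dim_row B, j div dim_col B) * B $$ (i mod dim_row B, j mod dim_col B))"

(* The nr x nc block matrix with a x b blocks F i k. As in the mathematical text the block
   indices i = 1, ..., nr and k = 1, ..., nc start from 1, whereas the scalar entries of
   matrices are indexed from 0 by the library. *)
definition block_mat ::
  "nat \<Rightarrow> nat \<Rightarrow> nat \<Rightarrow> nat \<Rightarrow> (nat \<Rightarrow> nat \<Rightarrow> complex mat) \<Rightarrow> complex mat" where
  "block_mat nr nc a b F =
     mat (nr * a) (nc * b) (\<lambda>(i, j). F (i div a + 1) (j div b + 1) $$ (i mod a, j mod b))"

definition block_col :: "nat \<Rightarrow> nat \<Rightarrow> nat \<Rightarrow> (nat \<Rightarrow> complex mat) \<Rightarrow> complex mat" where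
  "block_col n a b F = block_mat n 1 a b (\<lambda>i k. F i)"

definition block_row :: "nat \<Rightarrow> nat \<Rightarrow> nat \<Rightarrow> (nat \<Rightarrow> complex mat) \<Rightarrow> complex mat" where
  "block_row n a b F = block_mat 1 n a b (\<lambda>i k. F k)"

(* The row [A B]; the column of A and B is the library's append_rows. *)
definition append_cols :: "complex mat \<Rightarrow> complex mat \<Rightarrow> complex mat" (infixr \<open>@\<^sub>c\<close> 65) where
  "A @\<^sub>c B = four_block_mat A B (0\<^sub>m 0 (dim_col A)) (0\<^sub>m 0 (dim_col B))"

(* (1/2) f 0 + f 1 + ... + f (i - 1), for a x b matrices f s. The sum is taken entrywise
   because matrices of unspecified size form no additive monoid. *)
definition half_sum :: "nat \<Rightarrow> nat \<Rightarrow> (nat \<Rightarrow> complex mat) \<Rightarrow> nat \<Rightarrow> complex mat" where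
  "half_sum a b f i = (1/2) \<cdot>\<^sub>m f 0 + mat a b (\<lambda>xy. \<Sum>s\<in>{1..<i}. f s $$ xy)"

(* Only meaningful for invertible matrices: mat_inverse returns None otherwise. *)
definition inv_mat :: "complex mat \<Rightarrow> complex mat" where
  "inv_mat A = the (mat_inverse A)"

definition ones :: "nat \<Rightarrow> complex mat" where
  "ones r = mat r 1 (\<lambda>_. 1)"

definition exchange_mat :: "nat \<Rightarrow> complex mat" where
  "exchange_mat n = four_block_mat (0\<^sub>m n n) (1\<^sub>m n) (1\<^sub>m n) (0\<^sub>m n n)"

(* The scalar matrices written with a calligraphic A, of order n. *)
definition calA :: "nat \<Rightarrow> complex mat" where
  "calA n = mat n n (\<lambda>(j, l). if j < l then 0 else if j = l then \<i> / 2 else \<i>)"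

(* t r s is the block t^(r)_s. Only |r| < m1 and |s| < m2 matter; the values outside this
   range are never used. Points of C^2 are pairs, and the index p ranges over {1, 2}. *)
locale block_tbt =
  fixes m1 m2 m3 :: nat
    and t :: "int \<Rightarrow> int \<Rightarrow> complex mat"
begin

definition m :: nat where "m = m1 * m2 * m3"

definition calT :: "int \<Rightarrow> complex mat" where
  "calT r = block_mat m2 m2 m3 m3 (\<lambda>i k. t r (int i - int k))"

definition T :: "complex mat" where
  "T = block_mat m1 m1 (m2 * m3) (m2 * m3) (\<lambda>i k. calT (int i - int k))"

(* m_k and mu_k for the index k complementary to p, {k, p} = {1, 2} *)
definition m_other :: "nat \<Rightarrow> nat" where
  "m_other p = (if p = 1 then m2 else m1)"

definition other :: "nat \<Rightarrow> complex \<times> complex \<Rightarrow> complex" where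
  "other p \<mu> = (if p = 1 then snd \<mu> else fst \<mu>)"

definition J :: "nat \<Rightarrow> complex mat" where
  "J p = exchange_mat (m_other p * m3)"

definition A1 :: "complex mat" where "A1 = calA m1 \<otimes>\<^sub>K 1\<^sub>m m2 \<otimes>\<^sub>K 1\<^sub>m m3"
definition A2 :: "complex mat" where "A2 = 1\<^sub>m m1 \<otimes>\<^sub>K calA m2 \<otimes>\<^sub>K 1\<^sub>m m3"

definition L :: "complex mat" where "L = ones (m1 * m2) \<otimes>\<^sub>K 1\<^sub>m m3"
definition L1 :: "complex mat" where "L1 = ones m1 \<otimes>\<^sub>K 1\<^sub>m m3"
definition L2 :: "complex mat" where "L2 = ones m2 \<otimes>\<^sub>K 1\<^sub>m m3"

definition M11 :: "complex mat" where
  "M11 = block_col m1 (m2 * m3) (m2 * m3)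
     (half_sum (m2 * m3) (m2 * m3) (\<lambda>s. calT (int s)))"

definition M21 :: "complex mat" where "M21 = mat_adjoint (ones m1) \<otimes>\<^sub>K 1\<^sub>m (m2 * m3)"

definition M31 :: "complex mat" where "M31 = mat_adjoint M21"

definition M41 :: "complex mat" where
  "M41 = block_row m1 (m2 * m3) (m2 * m3)
     (half_sum (m2 * m3) (m2 * m3) (\<lambda>s. calT (- int s)))"

(* M12_blk r and M42_blk r are M_12^(r) and M_42^(r). *)
definition M12_blk :: "int \<Rightarrow> complex mat" where
  "M12_blk r = block_col m2 m3 m3 (half_sum m3 m3 (\<lambda>j. t r (int j)))"

definition M12 :: "complex mat" where
  "M12 = block_mat m1 m1 (m2 * m3) m3 (\<lambda>i k. M12_blk (int i - int k))"

definition M22 :: "complex mat" where "M22 = 1\<^sub>m m1 \<otimes>\<^sub>K mat_adjoint (ones m2) \<otimes>\<^sub>K 1\<^sub>m m3"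

definition M32 :: "complex mat" where "M32 = mat_adjoint M22"

definition M42_blk :: "int \<Rightarrow> complex mat" where
  "M42_blk r = block_row m2 m3 m3 (half_sum m3 m3 (\<lambda>l. t r (- int l)))"

definition M42 :: "complex mat" where
  "M42 = block_mat m1 m1 m3 (m2 * m3) (\<lambda>i k. M42_blk (int i - int k))"

definition R :: "complex mat" where "R = inv_mat T"

definition Pi_mat :: "nat \<Rightarrow> complex mat" where
  "Pi_mat p = (if p = 1 then M11 @\<^sub>c M31 else M12 @\<^sub>c M32)"

definition Pi_hat :: "nat \<Rightarrow> complex mat" where
  "Pi_hat p = (if p = 1 then M21 @\<^sub>r M41 else M22 @\<^sub>r M42)"

definition Gam :: "nat \<Rightarrow> complex mat" where "Gam p = R * Pi_mat p"

definition Gam_hat :: "nat \<Rightarrow> complex mat" where "Gam_hat p = Pi_hat p * R"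

definition v :: "nat \<Rightarrow> complex \<times> complex \<Rightarrow> complex mat" where
  "v p \<mu> = mat_adjoint L
     * (inv_mat (mat_adjoint A1 - fst \<mu> \<cdot>\<^sub>m 1\<^sub>m m) * inv_mat (mat_adjoint A2 - snd \<mu> \<cdot>\<^sub>m 1\<^sub>m m))
     * Gam p"

definition v_hat :: "nat \<Rightarrow> complex \<times> complex \<Rightarrow> complex mat" where
  "v_hat p w = Gam_hat p
     * (inv_mat (A1 - fst w \<cdot>\<^sub>m 1\<^sub>m m) * inv_mat (A2 - snd w \<cdot>\<^sub>m 1\<^sub>m m))
     * L"

definition u :: "nat \<Rightarrow> complex \<times> complex \<Rightarrow> complex mat" where
  "u p \<mu> = (let n = m_other p in
     v p \<mu> - \<i> \<cdot>\<^sub>m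
       (((mat_adjoint (ones n) * inv_mat (mat_adjoint (calA n) - other p \<mu> \<cdot>\<^sub>m 1\<^sub>m n)) \<otimes>\<^sub>K 1\<^sub>m m3)
        * (1\<^sub>m (n * m3) @\<^sub>c 0\<^sub>m (n * m3) (n * m3))))"

definition u_hat :: "nat \<Rightarrow> complex \<times> complex \<Rightarrow> complex mat" where
  "u_hat p w = (let n = m_other p in
     v_hat p w + \<i> \<cdot>\<^sub>m
       ((0\<^sub>m (n * m3) (n * m3) @\<^sub>r 1\<^sub>m (n * m3))
        * ((inv_mat (calA n - other p w \<cdot>\<^sub>m 1\<^sub>m n) * ones n) \<otimes>\<^sub>K 1\<^sub>m m3)))"

definition K11 :: "complex mat" where
  "K11 = block_col m1 m3 (m2 * m3) (half_sum m3 (m2 * m3) (\<lambda>j. M42_blk (int j)))"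

definition K12 :: "complex mat" where
  "K12 = block_row m1 (m2 * m3) m3 (half_sum (m2 * m3) m3 (\<lambda>j. M12_blk (- int j)))"

definition G21 :: "complex mat" where
  "G21 = \<i> \<cdot>\<^sub>m (Pi_hat 2 * Gam 1 -
     four_block_mat (L1 * mat_adjoint L2) (0\<^sub>m (m1 * m3) (m2 * m3))
                    K11                   (0\<^sub>m (m1 * m3) (m2 * m3)))"

definition G12 :: "complex mat" where
  "G12 = \<i> \<cdot>\<^sub>m (Pi_hat 1 * Gam 2 -
     four_block_mat (L2 * mat_adjoint L1) (0\<^sub>m (m2 * m3) (m1 * m3))
                    K12                   (0\<^sub>m (m2 * m3) (m1 * m3)))"

end

end

theory Submission
  imports Defs
begin

text \<open>
  Self-adjointness of \<open>T\<close> means, block by block, that the adjoint of \<open>t r s\<close> is \<open>t (- r) (- s)\<close>.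
  Each of the data matrices is built from half sums of these blocks, and passing to the adjoint
  exchanges the half sums over positive indices with those over negative indices. Hence
  \<open>M11\<close> and \<open>M41\<close>, \<open>M12\<close> and \<open>M42\<close>, \<open>K12\<close> and \<open>K11\<close> are adjoint to each other
  (\<open>M11_adjoint\<close>, \<open>M12_adjoint\<close>, \<open>K12_adjoint\<close>). Since \<open>M31\<close> and \<open>M21\<close>, \<open>M32\<close> and \<open>M22\<close>
  are adjoint by definition, the block column \<open>Pi_hat p\<close> consists of the two blocks of the
  adjoint of \<open>Pi_mat p\<close> in the opposite order. The matrix \<open>J p\<close> repairs the order:
  \<open>Pi_hat p = J p * mat_adjoint (Pi_mat p)\<close> (\<open>Pi_hat_eq\<close>), and as \<open>R\<close> is self-adjoint too,
  \<open>Gam_hat p = J p * mat_adjoint (Gam p)\<close>.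

  Everything else is formal. Taking the adjoint of \<open>v_hat\<close> at the conjugate point reverses
  the order of the two resolvents; they commute because \<open>A1\<close> and \<open>A2\<close> act on different tensor
  factors, so the result is \<open>v\<close> times \<open>J p\<close>. In the correction term of \<open>u_hat\<close> the
  matrix \<open>J p\<close> moves the identity block from the second place to the first (\<open>u_eq_u_hat_adjoint\<close>).
  For the off-diagonal blocks, multiplication by \<open>J 2\<close> and \<open>J 1\<close> turns the adjoint of
  \<open>Pi_hat 1 * Gam 2\<close> into \<open>Pi_hat 2 * Gam 1\<close>, while on a two by two block matrix it reverses
  both the rows and the columns. In the correction term of the adjoint of \<open>G12\<close>
  the block diagonal matrix with blocks \<open>L1 L2*\<close> and \<open>- L1 L2*\<close> removes the block
  \<open>L1 L2*\<close> from the upper left corner and inserts it in the lower right one, from which the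
  reversal brings it to the place that it has in \<open>G21\<close> (\<open>G21_eq\<close>).
\<close>

section \<open>Conjugate transposes\<close>

lemma dim_mat_adjoint [simp]:
  "dim_row (mat_adjoint A) = dim_col A" "dim_col (mat_adjoint A) = dim_row A"
  by (simp_all add: mat_adjoint_def)

lemma mat_adjoint_carrier [simp, intro]:
  "A \<in> carrier_mat n k \<Longrightarrow> mat_adjoint A \<in> carrier_mat k n"
  by (intro carrier_matI) simp_all

lemma index_mat_adjoint [simp]:
  fixes A :: "complex mat"
  shows "i < dim_col A \<Longrightarrow> j < dim_row A \<Longrightarrow> mat_adjoint A $$ (i, j) = cnj (A $$ (j, i))"
  by (simp add: mat_adjoint_def mat_of_rows_index)

lemma mat_adjoint_adjoint [simp]:
  fixes A :: "complex mat"
  shows "mat_adjoint (mat_adjoint A) = A"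
  by (rule eq_matI) simp_all

lemma mat_adjoint_mult:
  fixes A B :: "complex mat"
  assumes "A \<in> carrier_mat n k" "B \<in> carrier_mat k l"
  shows "mat_adjoint (A * B) = mat_adjoint B * mat_adjoint A"
  by (rule eq_matI) (use assms in \<open>auto simp: scalar_prod_def mult.commute\<close>)

lemma mat_adjoint_smult:
  fixes A :: "complex mat"
  shows "mat_adjoint (c \<cdot>\<^sub>m A) = cnj c \<cdot>\<^sub>m mat_adjoint A"
  by (rule eq_matI) simp_all

lemma mat_adjoint_add:
  fixes A B :: "complex mat"
  assumes "A \<in> carrier_mat n k" "B \<in> carrier_mat n k"
  shows "mat_adjoint (A + B) = mat_adjoint A + mat_adjoint B"
  by (rule eq_matI) (use assms in simp_all)

lemma mat_adjoint_minus:
  fixes A B :: "complex mat"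
  assumes "A \<in> carrier_mat n k" "B \<in> carrier_mat n k"
  shows "mat_adjoint (A - B) = mat_adjoint A - mat_adjoint B"
  by (rule eq_matI) (use assms in simp_all)

lemma mat_adjoint_one [simp]: "mat_adjoint (1\<^sub>m n :: complex mat) = 1\<^sub>m n"
  by (rule eq_matI) simp_all

lemma mat_adjoint_zero [simp]: "mat_adjoint (0\<^sub>m n k :: complex mat) = 0\<^sub>m k n"
  by (rule eq_matI) simp_all

lemma mat_adjoint_four_block_mat:
  fixes A B C D :: "complex mat"
  assumes "A \<in> carrier_mat r1 c1" "B \<in> carrier_mat r1 c2"
    "C \<in> carrier_mat r2 c1" "D \<in> carrier_mat r2 c2"
  shows "mat_adjoint (four_block_mat A B C D)
    = four_block_mat (mat_adjoint A) (mat_adjoint C) (mat_adjoint B) (mat_adjoint D)"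
  by (rule eq_matI) (use assms in auto)

lemma append_cols_carrier [simp, intro]:
  "A \<in> carrier_mat n k \<Longrightarrow> B \<in> carrier_mat n l \<Longrightarrow> A @\<^sub>c B \<in> carrier_mat n (k + l)"
  by (auto simp: append_cols_def)

lemma mat_adjoint_append_cols:
  assumes "A \<in> carrier_mat n k" "B \<in> carrier_mat n l"
  shows "mat_adjoint (A @\<^sub>c B) = mat_adjoint A @\<^sub>r mat_adjoint B"
  using assms unfolding append_cols_def append_rows_def
  by (subst mat_adjoint_four_block_mat) auto


section \<open>Block matrices\<close>

lemma block_mat_carrier [simp]: "block_mat nr nc a b F \<in> carrier_mat (nr * a) (nc * b)"
  by (simp add: block_mat_def)

lemma div_block_less: "i < n * a \<Longrightarrow> i div a < (n :: nat)"
  by (simp add: less_mult_imp_div_less)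

lemma mod_block_less: "i < n * a \<Longrightarrow> i mod a < (a :: nat)"
  by (metis mod_less_divisor mult_zero_right not_gr_zero not_less_zero)

lemma mat_adjoint_block_mat:
  assumes F: "\<And>i k. i \<in> {1..nr} \<Longrightarrow> k \<in> {1..nc} \<Longrightarrow> F i k \<in> carrier_mat a b"
    and G: "\<And>i k. i \<in> {1..nr} \<Longrightarrow> k \<in> {1..nc} \<Longrightarrow> G k i = mat_adjoint (F i k)"
  shows "mat_adjoint (block_mat nr nc a b F) = block_mat nc nr b a G"
proof (rule eq_matI)
  fix j i assume "j < dim_row (block_mat nc nr b a G)" "i < dim_col (block_mat nc nr b a G)"
  then have ji: "j < nc * b" "i < nr * a" by (simp_all add: block_mat_def)
  then have "i div a + 1 \<in> {1..nr}" "j div b + 1 \<in> {1..nc}"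
    by (simp_all add: Suc_le_eq div_block_less)
  note this F[OF this] G[OF this]
  then show "mat_adjoint (block_mat nr nc a b F) $$ (j, i) = block_mat nc nr b a G $$ (j, i)"
    using ji by (simp add: block_mat_def mod_block_less)
qed (simp_all add: block_mat_def)

text \<open>Every entry of a block occurs at some position of the large matrix. Applied at both block levels,
  this carries self-adjointness of \<open>T\<close> down to the blocks \<open>t r s\<close>.\<close>

lemma block_mat_inject:
  assumes eq: "block_mat nr nc a b F = block_mat nr nc a b G"
    and ik: "i \<in> {1..nr}" "k \<in> {1..nc}"
    and "F i k \<in> carrier_mat a b" "G i k \<in> carrier_mat a b"
  shows "F i k = G i k"
proof (rule eq_matI)
  fix x y assume "x < dim_row (G i k)" "y < dim_col (G i k)"
  then have xy: "x < a" "y < b" using assms by auto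
  define p where "p = (i - 1) * a + x"
  define q where "q = (k - 1) * b + y"
  have "p < Suc (i - 1) * a" "q < Suc (k - 1) * b" using xy by (simp_all add: p_def q_def)
  moreover have "Suc (i - 1) * a \<le> nr * a" "Suc (k - 1) * b \<le> nc * b"
    using ik by (intro mult_le_mono1; simp)+
  ultimately have "p < nr * a" "q < nc * b" by (meson less_le_trans)+
  moreover have "p div a + 1 = i" "p mod a = x" "q div b + 1 = k" "q mod b = y"
    using xy ik by (simp_all add: p_def q_def)
  ultimately have "block_mat nr nc a b H $$ (p, q) = H i k $$ (x, y)" for H
    by (simp add: block_mat_def)
  then show "F i k $$ (x, y) = G i k $$ (x, y)" using eq by metis
qed (use assms in auto)

lemma half_sum_carrier [simp]: "half_sum a b f i \<in> carrier_mat a b"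
  by (simp add: half_sum_def)

lemma mat_adjoint_half_sum:
  assumes f: "\<And>s. s < i \<Longrightarrow> f s \<in> carrier_mat a b"
    and g: "\<And>s. s < i \<Longrightarrow> g s = mat_adjoint (f s)" and "i \<ge> 1"
  shows "mat_adjoint (half_sum a b f i) = half_sum b a g i"
proof (rule eq_matI)
  fix y x assume "y < dim_row (half_sum b a g i)" "x < dim_col (half_sum b a g i)"
  then have yx: "y < b" "x < a" by (simp_all add: half_sum_def)
  have "g s $$ (y, x) = cnj (f s $$ (x, y))" if "s < i" for s
    using f[OF that] g[OF that] yx by simp
  then have "(\<Sum>s\<in>{1..<i}. g s $$ (y, x)) = (\<Sum>s\<in>{1..<i}. cnj (f s $$ (x, y)))"
    by (intro sum.cong) auto
  then show "mat_adjoint (half_sum a b f i) $$ (y, x) = half_sum b a g i $$ (y, x)"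
    using f[of 0] g[of 0] \<open>i \<ge> 1\<close> yx by (simp add: half_sum_def)
qed (simp_all add: half_sum_def)


section \<open>Kronecker products\<close>

lemma kron_carrier [simp]:
  "A \<in> carrier_mat n k \<Longrightarrow> B \<in> carrier_mat p q \<Longrightarrow> A \<otimes>\<^sub>K B \<in> carrier_mat (n * p) (k * q)"
  by (auto simp: kron_def)

lemma mat_adjoint_kron: "mat_adjoint (A \<otimes>\<^sub>K B) = mat_adjoint A \<otimes>\<^sub>K mat_adjoint B"
  by (rule eq_matI) (simp_all add: kron_def div_block_less mod_block_less)

text \<open>The index set of a Kronecker product is a product of index sets, encoded by division with
  remainder; a sum of separated terms over it therefore factorises.\<close>

lemma sum_product_div_mod:
  fixes f g :: "nat \<Rightarrow> 'a :: comm_semiring_0"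
  shows "(\<Sum>k<n * p. f (k div p) * g (k mod p)) = (\<Sum>i<n. f i) * (\<Sum>j<p. g j)"
proof (cases "p = 0")
  case False
  have "(\<Sum>k<n * p. f (k div p) * g (k mod p))
      = (\<Sum>i<n. \<Sum>k\<in>{i * p..<i * p + p}. f (k div p) * g (k mod p))"
    by (rule sum.nat_group[symmetric])
  also have "\<dots> = (\<Sum>i<n. \<Sum>j<p. f i * g j)"
  proof (rule sum.cong[OF refl])
    fix i
    show "(\<Sum>k\<in>{i * p..<i * p + p}. f (k div p) * g (k mod p)) = (\<Sum>j<p. f i * g j)"
      using sum.shift_bounds_nat_ivl[of "\<lambda>k. f (k div p) * g (k mod p)" 0 "i * p" p]
      by (auto simp: lessThan_atLeast0 add.commute intro!: sum.cong)
  qed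
  finally show ?thesis by (simp add: sum_product)
qed simp

lemma kron_mult:
  assumes A: "A \<in> carrier_mat n1 n2" and C: "C \<in> carrier_mat n2 n3"
    and B: "B \<in> carrier_mat p1 p2" and D: "D \<in> carrier_mat p2 p3"
  shows "(A \<otimes>\<^sub>K B) * (C \<otimes>\<^sub>K D) = (A * C) \<otimes>\<^sub>K (B * D)"
proof (rule eq_matI)
  fix i j assume "i < dim_row ((A * C) \<otimes>\<^sub>K (B * D))" "j < dim_col ((A * C) \<otimes>\<^sub>K (B * D))"
  then have ij: "i < n1 * p1" "j < n3 * p3" using assms by (auto simp: kron_def)
  then have bnd: "i div p1 < n1" "i mod p1 < p1" "j div p3 < n3" "j mod p3 < p3"
    by (simp_all add: div_block_less mod_block_less)
  have "((A \<otimes>\<^sub>K B) * (C \<otimes>\<^sub>K D)) $$ (i, j)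
      = (\<Sum>k<n2 * p2. (A $$ (i div p1, k div p2) * C $$ (k div p2, j div p3))
                     * (B $$ (i mod p1, k mod p2) * D $$ (k mod p2, j mod p3)))"
    using assms ij by (auto simp: kron_def scalar_prod_def lessThan_atLeast0 mult_ac intro!: sum.cong)
  also have "\<dots> = (\<Sum>k<n2. A $$ (i div p1, k) * C $$ (k, j div p3))
                 * (\<Sum>k<p2. B $$ (i mod p1, k) * D $$ (k, j mod p3))"
    by (rule sum_product_div_mod)
  also have "\<dots> = ((A * C) \<otimes>\<^sub>K (B * D)) $$ (i, j)"
    using assms ij bnd by (simp add: kron_def scalar_prod_def lessThan_atLeast0)
  finally show "((A \<otimes>\<^sub>K B) * (C \<otimes>\<^sub>K D)) $$ (i, j) = ((A * C) \<otimes>\<^sub>K (B * D)) $$ (i, j)" .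
qed (use assms in \<open>auto simp: kron_def\<close>)

text \<open>Matrices acting on different tensor factors commute; \<open>A1\<close> and \<open>A2\<close> are
  of this kind.\<close>

lemma kron_different_factors:
  assumes A: "A \<in> carrier_mat n n" and B: "B \<in> carrier_mat p p"
  shows "(A \<otimes>\<^sub>K 1\<^sub>m p) * (1\<^sub>m n \<otimes>\<^sub>K B) = A \<otimes>\<^sub>K B"
    and "(1\<^sub>m n \<otimes>\<^sub>K B) * (A \<otimes>\<^sub>K 1\<^sub>m p) = A \<otimes>\<^sub>K B"
  using kron_mult[OF A one_carrier_mat one_carrier_mat B]
    kron_mult[OF one_carrier_mat A B one_carrier_mat] A B
  by simp_all


section \<open>Inverses\<close>

lemma inv_mat_eqI:
  assumes A: "A \<in> carrier_mat n n" and B: "B \<in> carrier_mat n n" and AB: "A * B = 1\<^sub>m n"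
  shows "inv_mat A = B"
proof -
  have BA: "B * A = 1\<^sub>m n" by (rule mat_mult_left_right_inverse[OF A B AB])
  then have "A \<in> Units (ring_mat TYPE(complex) n ())"
    using A B AB by (auto simp: Units_def ring_mat_def)
  then obtain C where C: "mat_inverse A = Some C" using mat_inverse(1)[OF A] by fastforce
  from mat_inverse(2)[OF A C] have "A * C = 1\<^sub>m n" "C \<in> carrier_mat n n" by auto
  then have "C = B"
    using A B BA assoc_mult_mat[OF B A, of C n] by (metis left_mult_one_mat right_mult_one_mat)
  then show ?thesis using C by (simp add: inv_mat_def)
qed

lemma inv_mat_inverse:
  assumes A: "A \<in> carrier_mat n n" and "det A \<noteq> 0"
  shows "inv_mat A \<in> carrier_mat n n" "A * inv_mat A = 1\<^sub>m n" "inv_mat A * A = 1\<^sub>m n"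
proof -
  from det_non_zero_imp_unit[OF assms, of "()"]
  obtain B where B: "B \<in> carrier_mat n n" "A * B = 1\<^sub>m n" "B * A = 1\<^sub>m n"
    by (auto simp: Units_def ring_mat_def)
  with inv_mat_eqI[OF A] have "inv_mat A = B" by simp
  with B show "inv_mat A \<in> carrier_mat n n" "A * inv_mat A = 1\<^sub>m n" "inv_mat A * A = 1\<^sub>m n"
    by simp_all
qed

lemma det_nonzero_if_invertible:
  fixes A :: "complex mat"
  assumes A: "A \<in> carrier_mat n n" and "invertible_mat A"
  shows "det A \<noteq> 0"
proof -
  from assms obtain B where "A * B = 1\<^sub>m (dim_row A)" "B * A = 1\<^sub>m (dim_row B)"
    by (auto simp: invertible_mat_def inverts_mat_def)
  moreover from arg_cong[OF this(1), of dim_col] arg_cong[OF this(2), of dim_col]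
  have "B \<in> carrier_mat n n" using A by auto
  ultimately have "det A * det B = 1" using A by (metis carrier_matD(1) det_mult det_one)
  then show ?thesis by auto
qed

lemma inv_mat_adjoint:
  assumes A: "A \<in> carrier_mat n n" and "det A \<noteq> 0"
  shows "inv_mat (mat_adjoint A) = mat_adjoint (inv_mat A)"
proof (rule inv_mat_eqI[of _ n])
  note inv = inv_mat_inverse[OF assms]
  show "mat_adjoint A * mat_adjoint (inv_mat A) = 1\<^sub>m n"
    using mat_adjoint_mult[OF inv(1) A] inv(3) by simp
qed (rule mat_adjoint_carrier[OF A], rule mat_adjoint_carrier[OF inv_mat_inverse(1)[OF assms]])

text \<open>For commuting \<open>A\<close> and \<open>B\<close> this gives two expressions for the inverse of one matrix, so
  the inverses commute as well.\<close>

lemma inv_mat_mult: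
  assumes A: "A \<in> carrier_mat n n" "det A \<noteq> 0" and B: "B \<in> carrier_mat n n" "det B \<noteq> 0"
  shows "inv_mat (A * B) = inv_mat B * inv_mat A"
proof (rule inv_mat_eqI[of _ n])
  note a = inv_mat_inverse[OF A] and b = inv_mat_inverse[OF B]
  have "(A * B) * (inv_mat B * inv_mat A) = A * (B * (inv_mat B * inv_mat A))"
    using A B a b by (intro assoc_mult_mat) auto
  also have "B * (inv_mat B * inv_mat A) = (B * inv_mat B) * inv_mat A"
    using A B a b by (intro assoc_mult_mat[symmetric]) auto
  finally show "(A * B) * (inv_mat B * inv_mat A) = 1\<^sub>m n" using a b by simp
qed (use A(1) B(1) inv_mat_inverse(1)[OF A] inv_mat_inverse(1)[OF B] in simp_all)

lemma shift_carrier [simp]: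
  "A \<in> carrier_mat n n \<Longrightarrow> A - c \<cdot>\<^sub>m 1\<^sub>m n \<in> carrier_mat n n"
  by auto

lemma shift_mult_commute:
  fixes A B :: "complex mat"
  assumes A: "A \<in> carrier_mat n n" and B: "B \<in> carrier_mat n n" and AB: "A * B = B * A"
  shows "(A - a \<cdot>\<^sub>m 1\<^sub>m n) * (B - b \<cdot>\<^sub>m 1\<^sub>m n) = (B - b \<cdot>\<^sub>m 1\<^sub>m n) * (A - a \<cdot>\<^sub>m 1\<^sub>m n)"
proof -
  have "(A - a \<cdot>\<^sub>m 1\<^sub>m n) * (B - b \<cdot>\<^sub>m 1\<^sub>m n) = A * B - b \<cdot>\<^sub>m A - (a \<cdot>\<^sub>m B - (a * b) \<cdot>\<^sub>m 1\<^sub>m n)"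
    if "A \<in> carrier_mat n n" "B \<in> carrier_mat n n" for A B :: "complex mat" and a b
  proof -
    let ?I = "1\<^sub>m n :: complex mat"
    have "(A - a \<cdot>\<^sub>m ?I) * (B - b \<cdot>\<^sub>m ?I) = A * (B - b \<cdot>\<^sub>m ?I) - (a \<cdot>\<^sub>m ?I) * (B - b \<cdot>\<^sub>m ?I)"
      using that by (intro minus_mult_distrib_mat) auto
    also have "A * (B - b \<cdot>\<^sub>m ?I) = A * B - A * (b \<cdot>\<^sub>m ?I)"
      using that by (intro mult_minus_distrib_mat) auto
    also have "(a \<cdot>\<^sub>m ?I) * (B - b \<cdot>\<^sub>m ?I) = (a \<cdot>\<^sub>m ?I) * B - (a \<cdot>\<^sub>m ?I) * (b \<cdot>\<^sub>m ?I)"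
      using that by (intro mult_minus_distrib_mat) auto
    also have "A * (b \<cdot>\<^sub>m ?I) = b \<cdot>\<^sub>m A"
      using mult_smult_distrib[OF that(1) one_carrier_mat] that by simp
    also have "(a \<cdot>\<^sub>m ?I) * B = a \<cdot>\<^sub>m B"
      using mult_smult_assoc_mat[OF one_carrier_mat that(2)] that by simp
    also have "(a \<cdot>\<^sub>m ?I) * (b \<cdot>\<^sub>m ?I) = (a * b) \<cdot>\<^sub>m ?I"
      by (rule eq_matI) (auto simp: mult_smult_assoc_mat[of _ n n _ n] mult_smult_distrib[of _ n n _ n])
    finally show ?thesis .
  qed
  note e = this[OF A B, of a b] this[OF B A, of b a]
  show ?thesis unfolding e AB
    by (rule eq_matI) (use A B in \<open>auto simp: algebra_simps\<close>)
qed


section \<open>Lower triangular matrices with constant diagonal\<close>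

text \<open>The parameter \<open>d\<close> is the common value on the diagonal, hence the only eigenvalue. This class
  contains \<open>calA n\<close> and the identity and is closed under Kronecker products, which gives
  the resolvents of \<open>A1\<close> and \<open>A2\<close> at every point other than \<open>i/2\<close>.\<close>

definition lower_tri_diag :: "nat \<Rightarrow> complex \<Rightarrow> complex mat \<Rightarrow> bool" where
  "lower_tri_diag n d A \<longleftrightarrow> A \<in> carrier_mat n n \<and>
     (\<forall>i<n. A $$ (i, i) = d) \<and> (\<forall>i j. i < j \<longrightarrow> j < n \<longrightarrow> A $$ (i, j) = 0)"

lemma det_lower_tri_diag:
  assumes A: "lower_tri_diag n d A" and "d \<noteq> 0"
  shows "det A \<noteq> 0"
proof -
  have "det A = prod_list (diag_mat A)"
    using A by (intro det_lower_triangular[of n]) (auto simp: lower_tri_diag_def)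
  then show ?thesis
    using A \<open>d \<noteq> 0\<close> by (auto simp: lower_tri_diag_def diag_mat_def prod_list_zero_iff)
qed

lemma lower_tri_diag_one: "lower_tri_diag n 1 (1\<^sub>m n)"
  by (auto simp: lower_tri_diag_def)

lemma lower_tri_diag_calA: "lower_tri_diag n (\<i> / 2) (calA n)"
  by (auto simp: lower_tri_diag_def calA_def)

lemma lower_tri_diag_shift:
  "lower_tri_diag n d A \<Longrightarrow> lower_tri_diag n (d - c) (A - c \<cdot>\<^sub>m 1\<^sub>m n)"
  by (auto simp: lower_tri_diag_def)

text \<open>Division with remainder orders the double indices lexicographically, and this order makes a
  product of lower triangular matrices lower triangular.\<close>

lemma lower_tri_diag_kron:
  assumes A: "lower_tri_diag n d A" and B: "lower_tri_diag p e B"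
  shows "lower_tri_diag (n * p) (d * e) (A \<otimes>\<^sub>K B)"
  unfolding lower_tri_diag_def
proof (intro conjI allI impI)
  show "A \<otimes>\<^sub>K B \<in> carrier_mat (n * p) (n * p)" using assms by (simp add: lower_tri_diag_def)
next
  fix i assume "i < n * p"
  then show "(A \<otimes>\<^sub>K B) $$ (i, i) = d * e"
    using assms by (auto simp: lower_tri_diag_def kron_def div_block_less mod_block_less)
next
  fix i j assume ij: "i < j" "j < n * p"
  then have bnd: "i div p < n" "j div p < n" "i mod p < p" "j mod p < p"
    using div_block_less[of _ n p] mod_block_less[of _ n p] by auto
  have "i div p < j div p \<or> i div p = j div p \<and> i mod p < j mod p"
    using ij div_le_mono[of i j p] div_mult_mod_eq[of i p] div_mult_mod_eq[of j p]
    by (metis le_neq_implies_less less_imp_le_nat nat_add_left_cancel_less)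
  then show "(A \<otimes>\<^sub>K B) $$ (i, j) = 0"
    using assms ij bnd by (auto simp: lower_tri_diag_def kron_def)
qed


section \<open>The block exchange matrix\<close>

lemma exchange_mat_carrier [simp]: "exchange_mat n \<in> carrier_mat (n + n) (n + n)"
  by (simp add: exchange_mat_def)

lemma mat_adjoint_exchange_mat [simp]: "mat_adjoint (exchange_mat n) = exchange_mat n"
  unfolding exchange_mat_def by (subst mat_adjoint_four_block_mat) auto

lemma exchange_mat_append_rows:
  assumes "A \<in> carrier_mat n k" "B \<in> carrier_mat n k"
  shows "exchange_mat n * (A @\<^sub>r B) = B @\<^sub>r A"
  using assms unfolding exchange_mat_def append_rows_def
  by (subst mult_four_block_mat) auto

lemma append_cols_exchange_mat:
  assumes "A \<in> carrier_mat k n" "B \<in> carrier_mat k n"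
  shows "(A @\<^sub>c B) * exchange_mat n = B @\<^sub>c A"
  using assms unfolding exchange_mat_def append_cols_def
  by (subst mult_four_block_mat) auto

lemma exchange_mat_square: "exchange_mat n * exchange_mat n = 1\<^sub>m (n + n)"
  unfolding exchange_mat_def by (subst mult_four_block_mat) auto

lemma exchange_four_block_exchange:
  assumes "A \<in> carrier_mat n k" "B \<in> carrier_mat n k" "C \<in> carrier_mat n k" "D \<in> carrier_mat n k"
  shows "exchange_mat n * four_block_mat A B C D * exchange_mat k = four_block_mat D C B A"
proof -
  have "exchange_mat n * four_block_mat A B C D = four_block_mat C D A B"
    using assms unfolding exchange_mat_def by (subst mult_four_block_mat) auto
  also have "\<dots> * exchange_mat k = four_block_mat D C B A"
    using assms unfolding exchange_mat_def by (subst mult_four_block_mat) auto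
  finally show ?thesis .
qed


section \<open>The matrices attached to a block TBT-matrix\<close>

context block_tbt
begin

lemma calT_carrier [simp]: "calT r \<in> carrier_mat (m2 * m3) (m2 * m3)"
  unfolding calT_def by (rule block_mat_carrier)

lemma T_carrier [simp]: "T \<in> carrier_mat m m"
  unfolding T_def m_def using block_mat_carrier[of m1 m1 "m2 * m3" "m2 * m3"] by (simp add: mult.assoc)

lemma M12_blk_carrier [simp]: "M12_blk r \<in> carrier_mat (m2 * m3) m3"
  unfolding M12_blk_def block_col_def using block_mat_carrier[of m2 1 m3 m3] by simp

lemma M42_blk_carrier [simp]: "M42_blk r \<in> carrier_mat m3 (m2 * m3)"
  unfolding M42_blk_def block_row_def using block_mat_carrier[of 1 m2 m3 m3] by simp

lemma M_carriers [simp]: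
  "M11 \<in> carrier_mat m (m2 * m3)" "M31 \<in> carrier_mat m (m2 * m3)"
  "M12 \<in> carrier_mat m (m1 * m3)" "M32 \<in> carrier_mat m (m1 * m3)"
  by (auto simp: M11_def M31_def M21_def M12_def M32_def M22_def block_col_def block_mat_def
      kron_def ones_def m_def)

lemma L_carrier [simp]: "L \<in> carrier_mat m m3"
  unfolding L_def m_def using kron_carrier[of "ones (m1 * m2)" "m1 * m2" 1 "1\<^sub>m m3" m3 m3]
  by (simp add: ones_def)

lemma m_other_simps [simp]: "m_other 1 = m2" "m_other 2 = m1" "m_other (Suc 0) = m2"
  by (simp_all add: m_other_def)

lemma Pi_mat_carrier [simp]:
  "p \<in> {1, 2} \<Longrightarrow> Pi_mat p \<in> carrier_mat m (m_other p * m3 + m_other p * m3)"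
  by (auto simp: Pi_mat_def)

lemma J_carrier [simp]:
  "J p \<in> carrier_mat (m_other p * m3 + m_other p * m3) (m_other p * m3 + m_other p * m3)"
  by (simp add: J_def)

lemma J_adjoint [simp]: "mat_adjoint (J p) = J p"
  by (simp add: J_def)

lemma J_square: "J p * J p = 1\<^sub>m (m_other p * m3 + m_other p * m3)"
  by (simp add: J_def exchange_mat_square)

lemma lower_tri_diag_A1: "lower_tri_diag m (\<i> / 2) A1"
  using lower_tri_diag_kron[OF lower_tri_diag_kron[OF lower_tri_diag_calA[of m1] lower_tri_diag_one[of m2]]
      lower_tri_diag_one[of m3]]
  by (simp add: A1_def m_def)

lemma lower_tri_diag_A2: "lower_tri_diag m (\<i> / 2) A2"
  using lower_tri_diag_kron[OF lower_tri_diag_kron[OF lower_tri_diag_one[of m1] lower_tri_diag_calA[of m2]]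
      lower_tri_diag_one[of m3]]
  by (simp add: A2_def m_def)

lemma A_carrier [simp]: "A1 \<in> carrier_mat m m" "A2 \<in> carrier_mat m m"
  using lower_tri_diag_A1 lower_tri_diag_A2 by (simp_all add: lower_tri_diag_def)

lemma A1_A2_commute: "A1 * A2 = A2 * A1"
proof -
  have A: "calA m1 \<in> carrier_mat m1 m1" "calA m2 \<in> carrier_mat m2 m2" by (simp_all add: calA_def)
  let ?X = "calA m1 \<otimes>\<^sub>K 1\<^sub>m m2" and ?Y = "1\<^sub>m m1 \<otimes>\<^sub>K calA m2"
  have XY: "?X \<in> carrier_mat (m1 * m2) (m1 * m2)" "?Y \<in> carrier_mat (m1 * m2) (m1 * m2)"
    using A by simp_all
  have "A1 * A2 = (?X * ?Y) \<otimes>\<^sub>K (1\<^sub>m m3 * 1\<^sub>m m3)"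
    unfolding A1_def A2_def by (rule kron_mult[OF XY one_carrier_mat one_carrier_mat])
  also have "?X * ?Y = ?Y * ?X" by (simp only: kron_different_factors[OF A])
  also have "(?Y * ?X) \<otimes>\<^sub>K (1\<^sub>m m3 * 1\<^sub>m m3) = A2 * A1"
    unfolding A1_def A2_def by (rule kron_mult[OF XY(2,1) one_carrier_mat one_carrier_mat, symmetric])
  finally show ?thesis .
qed

end


section \<open>Consequences of self-adjointness\<close>

locale self_adjoint_block_tbt = block_tbt +
  assumes t_carrier: "\<bar>r\<bar> < int m1 \<Longrightarrow> \<bar>s\<bar> < int m2 \<Longrightarrow> t r s \<in> carrier_mat m3 m3"
    and T_adjoint: "mat_adjoint T = T"
    and T_invertible: "invertible_mat T"
begin

lemma calT_adjoint:
  assumes "\<bar>r\<bar> < int m1"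
  shows "mat_adjoint (calT r) = calT (- r)"
proof -
  \<comment> \<open>A block of \<open>T\<close> with index difference \<open>r\<close>: one of the two indices is \<open>1\<close>.\<close>
  define i where "i = nat (max r 0) + 1"
  define k where "k = nat (max (- r) 0) + 1"
  have ik: "i \<in> {1..m1}" "k \<in> {1..m1}" and r: "int i - int k = r" "int k - int i = - r"
    using assms by (auto simp: i_def k_def)
  have "block_mat m1 m1 (m2 * m3) (m2 * m3) (\<lambda>i k. mat_adjoint (calT (int k - int i)))
      = block_mat m1 m1 (m2 * m3) (m2 * m3) (\<lambda>i k. calT (int i - int k))"
    using T_adjoint unfolding T_def
    by (subst (asm) mat_adjoint_block_mat[where G = "\<lambda>i k. mat_adjoint (calT (int k - int i))"]) auto
  from block_mat_inject[OF this ik(2,1)] show ?thesis unfolding r by simp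
qed

lemma t_adjoint:
  assumes r: "\<bar>r\<bar> < int m1" and s: "\<bar>s\<bar> < int m2"
  shows "mat_adjoint (t r s) = t (- r) (- s)"
proof -
  define i where "i = nat (max s 0) + 1"
  define k where "k = nat (max (- s) 0) + 1"
  have ik: "i \<in> {1..m2}" "k \<in> {1..m2}" and s': "int i - int k = s" "int k - int i = - s"
    using s by (auto simp: i_def k_def)
  have "block_mat m2 m2 m3 m3 (\<lambda>i k. mat_adjoint (t r (int k - int i)))
      = block_mat m2 m2 m3 m3 (\<lambda>i k. t (- r) (int i - int k))"
    using calT_adjoint[OF r] r unfolding calT_def
    by (subst (asm) mat_adjoint_block_mat[where G = "\<lambda>i k. mat_adjoint (t r (int k - int i))"])
       (auto intro!: t_carrier)
  from block_mat_inject[OF this ik(2,1)] show ?thesis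
    unfolding s' using r s t_carrier[of r s] t_carrier[of "- r" "- s"] by simp
qed

lemma M12_blk_adjoint:
  assumes "\<bar>r\<bar> < int m1"
  shows "mat_adjoint (M12_blk r) = M42_blk (- r)"
  unfolding M12_blk_def M42_blk_def block_col_def block_row_def
proof (rule mat_adjoint_block_mat)
  fix i k assume "i \<in> {1..m2}"
  then show "half_sum m3 m3 (\<lambda>l. t (- r) (- int l)) i
      = mat_adjoint (half_sum m3 m3 (\<lambda>j. t r (int j)) i)"
    using assms by (intro mat_adjoint_half_sum[symmetric]) (auto simp: t_adjoint intro!: t_carrier)
qed simp

lemma M11_adjoint: "mat_adjoint M11 = M41"
  unfolding M11_def M41_def block_col_def block_row_def
  by (rule mat_adjoint_block_mat)
     (auto intro!: mat_adjoint_half_sum[symmetric] simp: calT_adjoint)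

lemma M12_adjoint: "mat_adjoint M12 = M42"
  unfolding M12_def M42_def
  by (rule mat_adjoint_block_mat) (auto simp: M12_blk_adjoint)

lemma K12_adjoint: "mat_adjoint K12 = K11"
  unfolding K12_def K11_def block_col_def block_row_def
  by (rule mat_adjoint_block_mat)
     (auto intro!: mat_adjoint_half_sum[symmetric] simp: M12_blk_adjoint)

text \<open>This is where the matrices \<open>J p\<close> come from: the blocks of the adjoint of \<open>Pi_mat p\<close> are
  those of \<open>Pi_hat p\<close> in the opposite order.\<close>

lemma Pi_hat_eq:
  assumes "p \<in> {1, 2}"
  shows "Pi_hat p = J p * mat_adjoint (Pi_mat p)"
proof -
  have [simp]: "mat_adjoint M31 = M21" "mat_adjoint M32 = M22" by (simp_all add: M31_def M32_def)
  have 1: "mat_adjoint (M11 @\<^sub>c M31) = M41 @\<^sub>r M21"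
    by (simp add: mat_adjoint_append_cols[OF M_carriers(1,2)] M11_adjoint)
  have 2: "mat_adjoint (M12 @\<^sub>c M32) = M42 @\<^sub>r M22"
    by (simp add: mat_adjoint_append_cols[OF M_carriers(3,4)] M12_adjoint)
  have c: "M41 \<in> carrier_mat (m2 * m3) m" "M21 \<in> carrier_mat (m2 * m3) m"
    "M42 \<in> carrier_mat (m1 * m3) m" "M22 \<in> carrier_mat (m1 * m3) m"
    using mat_adjoint_carrier[OF M_carriers(1)] mat_adjoint_carrier[OF M_carriers(2)]
      mat_adjoint_carrier[OF M_carriers(3)] mat_adjoint_carrier[OF M_carriers(4)]
    by (simp_all add: M11_adjoint M12_adjoint)
  show ?thesis
    using assms c
    by (auto simp: Pi_hat_def Pi_mat_def 1 2 J_def exchange_mat_append_rows[where k = m])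
qed

lemma R_carrier [simp]: "R \<in> carrier_mat m m"
  and R_adjoint: "mat_adjoint R = R"
  using inv_mat_inverse(1)[OF T_carrier] inv_mat_adjoint[OF T_carrier]
    det_nonzero_if_invertible[OF T_carrier T_invertible] T_adjoint
  by (simp_all add: R_def)

lemma Gam_carrier [simp]:
  "p \<in> {1, 2} \<Longrightarrow> Gam p \<in> carrier_mat m (m_other p * m3 + m_other p * m3)"
  unfolding Gam_def by (rule mult_carrier_mat[OF R_carrier Pi_mat_carrier])

lemma Gam_adjoint: "p \<in> {1, 2} \<Longrightarrow> mat_adjoint (Gam p) = mat_adjoint (Pi_mat p) * R"
  unfolding Gam_def by (subst mat_adjoint_mult[OF R_carrier Pi_mat_carrier]) (simp_all add: R_adjoint)

lemma Gam_hat_eq: "p \<in> {1, 2} \<Longrightarrow> Gam_hat p = J p * mat_adjoint (Gam p)"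
  unfolding Gam_hat_def Pi_hat_eq Gam_adjoint
  by (rule assoc_mult_mat[OF J_carrier mat_adjoint_carrier[OF Pi_mat_carrier] R_carrier])

lemma Gam_hat_adjoint:
  assumes "p \<in> {1, 2}"
  shows "mat_adjoint (Gam_hat p) = Gam p * J p"
  using assms unfolding Gam_hat_eq[OF assms]
  by (subst mat_adjoint_mult[OF J_carrier mat_adjoint_carrier[OF Gam_carrier]]) simp_all


section \<open>The functions u and v\<close>

text \<open>The adjoint of \<open>v_hat\<close> ends with the factor \<open>Gam p * J p\<close>; it is \<open>J p * J p = 1\<close> that
  cancels the final \<open>J p\<close>.\<close>

lemma v_eq_v_hat_adjoint:
  assumes p: "p \<in> {1, 2}" and \<mu>: "\<mu>1 \<noteq> - \<i> / 2" "\<mu>2 \<noteq> - \<i> / 2"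
  shows "v p (\<mu>1, \<mu>2) = mat_adjoint (v_hat p (cnj \<mu>1, cnj \<mu>2)) * J p"
    and "v_hat p (cnj \<mu>1, cnj \<mu>2) \<in> carrier_mat (m_other p * m3 + m_other p * m3) m3"
proof -
  let ?B1 = "A1 - cnj \<mu>1 \<cdot>\<^sub>m 1\<^sub>m m" and ?B2 = "A2 - cnj \<mu>2 \<cdot>\<^sub>m 1\<^sub>m m"
  let ?k = "m_other p * m3 + m_other p * m3"
  have B: "?B1 \<in> carrier_mat m m" "?B2 \<in> carrier_mat m m" by simp_all
  \<comment> \<open>The adjoint of an inverse is the inverse of the adjoint only where the inverse exists: this is
    the role of the hypotheses on \<open>\<mu>1\<close> and \<open>\<mu>2\<close>.\<close>
  have "\<i> / 2 - cnj \<mu>1 \<noteq> 0" "\<i> / 2 - cnj \<mu>2 \<noteq> 0"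
    using \<mu> by (auto simp: complex_eq_iff)
  then have det: "det ?B1 \<noteq> 0" "det ?B2 \<noteq> 0"
    using det_lower_tri_diag lower_tri_diag_shift lower_tri_diag_A1 lower_tri_diag_A2 by blast+
  define X1 where "X1 = inv_mat ?B1"
  define X2 where "X2 = inv_mat ?B2"
  have X: "X1 \<in> carrier_mat m m" "X2 \<in> carrier_mat m m"
    using inv_mat_inverse(1)[OF B(1) det(1)] inv_mat_inverse(1)[OF B(2) det(2)]
    by (simp_all add: X1_def X2_def)
  have "X2 * X1 = inv_mat (?B1 * ?B2)" "X1 * X2 = inv_mat (?B2 * ?B1)"
    using inv_mat_mult[OF B(1) det(1) B(2) det(2)] inv_mat_mult[OF B(2) det(2) B(1) det(1)]
    by (simp_all add: X1_def X2_def)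
  \<comment> \<open>Both products are the inverse of the same matrix, because the shifted matrices commute.\<close>
  then have comm: "X1 * X2 = X2 * X1"
    using shift_mult_commute[OF A_carrier A1_A2_commute, of "cnj \<mu>1" "cnj \<mu>2"] by simp
  have adj: "mat_adjoint A1 - \<mu>1 \<cdot>\<^sub>m 1\<^sub>m m = mat_adjoint ?B1" "mat_adjoint A2 - \<mu>2 \<cdot>\<^sub>m 1\<^sub>m m = mat_adjoint ?B2"
    by (simp_all add: mat_adjoint_minus[of _ m m] mat_adjoint_smult)
  have inv: "inv_mat (mat_adjoint ?B1) = mat_adjoint X1" "inv_mat (mat_adjoint ?B2) = mat_adjoint X2"
    using inv_mat_adjoint[OF B(1) det(1)] inv_mat_adjoint[OF B(2) det(2)] by (simp_all add: X1_def X2_def)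
  have X12: "X1 * X2 \<in> carrier_mat m m" using X by simp
  have G: "Gam_hat p \<in> carrier_mat ?k m"
    using p unfolding Gam_hat_eq[OF p]
    by (intro mult_carrier_mat[OF J_carrier mat_adjoint_carrier[OF Gam_carrier]])
  have vh: "v_hat p (cnj \<mu>1, cnj \<mu>2) = Gam_hat p * (X1 * X2) * L"
    by (simp add: v_hat_def X1_def X2_def)
  show "v_hat p (cnj \<mu>1, cnj \<mu>2) \<in> carrier_mat ?k m3"
    unfolding vh by (intro mult_carrier_mat[OF mult_carrier_mat[OF G X12] L_carrier])
  have "mat_adjoint (v_hat p (cnj \<mu>1, cnj \<mu>2)) = mat_adjoint L * mat_adjoint (Gam_hat p * (X1 * X2))"
    unfolding vh by (rule mat_adjoint_mult[OF mult_carrier_mat[OF G X12] L_carrier])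
  also have "mat_adjoint (Gam_hat p * (X1 * X2)) = mat_adjoint (X1 * X2) * (Gam p * J p)"
    using mat_adjoint_mult[OF G X12] by (simp add: Gam_hat_adjoint[OF p])
  also have "mat_adjoint (X1 * X2) = mat_adjoint X1 * mat_adjoint X2"
    unfolding comm by (rule mat_adjoint_mult[OF X(2,1)])
  finally have "mat_adjoint (v_hat p (cnj \<mu>1, cnj \<mu>2)) * J p
      = mat_adjoint L * (mat_adjoint X1 * mat_adjoint X2 * (Gam p * J p)) * J p" by simp
  also have "\<dots> = mat_adjoint L * (mat_adjoint X1 * mat_adjoint X2) * Gam p"
  proof -
    have c: "mat_adjoint L \<in> carrier_mat m3 m" "mat_adjoint X1 * mat_adjoint X2 \<in> carrier_mat m m"
      "Gam p \<in> carrier_mat m ?k" "J p \<in> carrier_mat ?k ?k"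
      using X p by auto
    \<comment> \<open>Associativity is applied to variables, so that the simplifier does not rewrite inside the factors.\<close>
    have "Z * (Y * (W * H)) * H = Z * Y * W" if "Z \<in> carrier_mat m3 m" "Y \<in> carrier_mat m m"
      "W \<in> carrier_mat m ?k" "H \<in> carrier_mat ?k ?k" "H * H = 1\<^sub>m ?k" for Z Y W H :: "complex mat"
    proof -
      have "Y * (W * H) = Y * W * H" using that by (intro assoc_mult_mat[symmetric]) auto
      then have "Z * (Y * (W * H)) * H = Z * (Y * W * H * H)"
        using that by (simp add: assoc_mult_mat[of _ m3 m _ ?k _ ?k])
      also have "Y * W * H * H = Y * W * (H * H)" using that by (intro assoc_mult_mat) auto
      also have "\<dots> = Y * W" using that by simp
      finally show ?thesis using that by (simp add: assoc_mult_mat[of _ m3 m _ m _ ?k])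
    qed
    from this[OF c J_square] show ?thesis .
  qed
  finally show "v p (\<mu>1, \<mu>2) = mat_adjoint (v_hat p (cnj \<mu>1, cnj \<mu>2)) * J p"
    by (simp add: v_def adj inv)
qed

text \<open>In the correction term the adjoint contributes the sign of \<open>- i\<close>, and \<open>J p\<close> turns the row with
  the identity in second place, which the adjoint produces, into the one with the identity in front.\<close>

lemma u_eq_u_hat_adjoint:
  assumes p: "p \<in> {1, 2}" and \<mu>: "\<mu>1 \<noteq> - \<i> / 2" "\<mu>2 \<noteq> - \<i> / 2"
  shows "u p (\<mu>1, \<mu>2) = mat_adjoint (u_hat p (cnj \<mu>1, cnj \<mu>2)) * J p"
proof -
  define n where "n = m_other p"
  define c where "c = other p (\<mu>1, \<mu>2)"
  have c: "other p (cnj \<mu>1, cnj \<mu>2) = cnj c" by (simp add: c_def other_def)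
  let ?k = "n * m3 + n * m3"
  let ?B = "calA n - cnj c \<cdot>\<^sub>m 1\<^sub>m n"
  have B: "?B \<in> carrier_mat n n" by (simp add: calA_def)
  have "\<i> / 2 - cnj c \<noteq> 0" using \<mu> by (auto simp: complex_eq_iff c_def other_def)
  then have det: "det ?B \<noteq> 0"
    using det_lower_tri_diag lower_tri_diag_shift lower_tri_diag_calA by blast
  define Y where "Y = (inv_mat ?B * ones n) \<otimes>\<^sub>K 1\<^sub>m m3"
  have one: "ones n \<in> carrier_mat n 1" by (simp add: ones_def)
  note invB = inv_mat_inverse(1)[OF B det]
  have "Y \<in> carrier_mat (n * m3) (1 * m3)"
    unfolding Y_def by (intro kron_carrier mult_carrier_mat[OF invB one]) simp
  then have Y: "Y \<in> carrier_mat (n * m3) m3" by simp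
  have "mat_adjoint (calA n) - c \<cdot>\<^sub>m 1\<^sub>m n = mat_adjoint ?B"
    by (simp add: mat_adjoint_minus[of _ n n] mat_adjoint_smult calA_def)
  then have Yadj: "(mat_adjoint (ones n) * inv_mat (mat_adjoint (calA n) - c \<cdot>\<^sub>m 1\<^sub>m n)) \<otimes>\<^sub>K 1\<^sub>m m3
      = mat_adjoint Y"
    unfolding Y_def by (simp add: mat_adjoint_kron mat_adjoint_mult[OF invB one] inv_mat_adjoint[OF B det])
  let ?O = "0\<^sub>m (n * m3) (n * m3) :: complex mat" and ?I = "1\<^sub>m (n * m3) :: complex mat"
  have OI: "?O @\<^sub>c ?I \<in> carrier_mat (n * m3) ?k" "?O @\<^sub>r ?I \<in> carrier_mat ?k (n * m3)" by auto
  have "mat_adjoint (?O @\<^sub>c ?I) = ?O @\<^sub>r ?I"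
    by (subst mat_adjoint_append_cols[of _ "n * m3" "n * m3" _ "n * m3"]) simp_all
  then have E: "mat_adjoint (?O @\<^sub>r ?I) = ?O @\<^sub>c ?I" by (metis mat_adjoint_adjoint)
  have YOI: "mat_adjoint Y * (?O @\<^sub>c ?I) \<in> carrier_mat m3 ?k"
    by (rule mult_carrier_mat[OF mat_adjoint_carrier[OF Y] OI(1)])
  have J: "J p = exchange_mat (n * m3)" by (simp add: J_def n_def)
  let ?vh = "v_hat p (cnj \<mu>1, cnj \<mu>2)"
  let ?w = "(?O @\<^sub>r ?I) * Y"
  have w: "?w \<in> carrier_mat ?k m3" using OI Y by (intro mult_carrier_mat)
  have vh: "?vh \<in> carrier_mat ?k m3" using v_eq_v_hat_adjoint(2)[OF p \<mu>] by (simp add: n_def)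
  have "mat_adjoint (u_hat p (cnj \<mu>1, cnj \<mu>2)) = mat_adjoint (?vh + \<i> \<cdot>\<^sub>m ?w)"
    by (simp add: u_hat_def Let_def c Y_def flip: n_def)
  also have "\<dots> = mat_adjoint ?vh + (- \<i>) \<cdot>\<^sub>m (mat_adjoint Y * (?O @\<^sub>c ?I))"
    using w vh by (simp add: mat_adjoint_add[of _ ?k m3] mat_adjoint_smult mat_adjoint_mult[OF OI(2) Y] E)
  also have "\<dots> * J p = mat_adjoint ?vh * J p + (- \<i>) \<cdot>\<^sub>m (mat_adjoint Y * (?O @\<^sub>c ?I)) * J p"
    using vh YOI J by (intro add_mult_distrib_mat[of _ m3 ?k _ _ ?k]) auto
  also have "(- \<i>) \<cdot>\<^sub>m (mat_adjoint Y * (?O @\<^sub>c ?I)) * J p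
      = (- \<i>) \<cdot>\<^sub>m (mat_adjoint Y * (?O @\<^sub>c ?I) * J p)"
    using YOI J by (intro mult_smult_assoc_mat[of _ m3 ?k _ ?k]) auto
  also have "mat_adjoint Y * (?O @\<^sub>c ?I) * J p = mat_adjoint Y * ((?O @\<^sub>c ?I) * J p)"
    using Y OI J by (intro assoc_mult_mat[of _ m3 "n * m3" _ ?k _ ?k]) auto
  also have "(?O @\<^sub>c ?I) * J p = ?I @\<^sub>c ?O"
    unfolding J by (rule append_cols_exchange_mat[OF zero_carrier_mat one_carrier_mat])
  also have "mat_adjoint ?vh * J p = v p (\<mu>1, \<mu>2)" using v_eq_v_hat_adjoint(1)[OF p \<mu>] by simp
  also have "v p (\<mu>1, \<mu>2) + (- \<i>) \<cdot>\<^sub>m (mat_adjoint Y * (?I @\<^sub>c ?O)) = u p (\<mu>1, \<mu>2)"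
    unfolding u_def Let_def n_def[symmetric] c_def[symmetric] Yadj
    by (rule eq_matI) simp_all
  finally show ?thesis by simp
qed


section \<open>The constant off-diagonal blocks\<close>

text \<open>Both products contain the same matrix \<open>mat_adjoint (Pi_mat 2) * R * Pi_mat 1\<close>, because \<open>R\<close> is
  self-adjoint; they differ from it only by the exchange matrix that each \<open>Pi_hat\<close> brings along.\<close>

lemma Pi_hat_Gam:
  "mat_adjoint (Pi_hat 1 * Gam 2) = mat_adjoint (Pi_mat 2) * R * Pi_mat 1 * J 1"
  "J 2 * (mat_adjoint (Pi_mat 2) * R * Pi_mat 1) = Pi_hat 2 * Gam 1"
proof -
  have P: "Pi_mat 1 \<in> carrier_mat m (m2 * m3 + m2 * m3)" "Pi_mat 2 \<in> carrier_mat m (m1 * m3 + m1 * m3)"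
    using Pi_mat_carrier[of 1] Pi_mat_carrier[of 2] by simp_all
  have Jc: "J 1 \<in> carrier_mat (m2 * m3 + m2 * m3) (m2 * m3 + m2 * m3)"
    "J 2 \<in> carrier_mat (m1 * m3 + m1 * m3) (m1 * m3 + m1 * m3)"
    using J_carrier[of 1] J_carrier[of 2] by simp_all
  have G: "Gam 2 \<in> carrier_mat m (m1 * m3 + m1 * m3)" using Gam_carrier[of 2] by simp
  have S: "mat_adjoint (Pi_mat 2) * R \<in> carrier_mat (m1 * m3 + m1 * m3) m"
    using P by (intro mult_carrier_mat) auto
  have H: "Pi_hat 1 = J 1 * mat_adjoint (Pi_mat 1)" "Pi_hat 2 = J 2 * mat_adjoint (Pi_mat 2)"
    by (simp_all add: Pi_hat_eq)
  have Hc: "Pi_hat 1 \<in> carrier_mat (m2 * m3 + m2 * m3) m"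
    unfolding H by (intro mult_carrier_mat[OF Jc(1)] mat_adjoint_carrier[OF P(1)])
  have "mat_adjoint (Pi_hat 1 * Gam 2) = mat_adjoint (Gam 2) * mat_adjoint (Pi_hat 1)"
    by (rule mat_adjoint_mult[OF Hc G])
  also have "mat_adjoint (Gam 2) = mat_adjoint (Pi_mat 2) * R" by (simp add: Gam_adjoint)
  also have "mat_adjoint (Pi_hat 1) = Pi_mat 1 * J 1"
    unfolding H mat_adjoint_mult[OF Jc(1) mat_adjoint_carrier[OF P(1)]] by simp
  finally show "mat_adjoint (Pi_hat 1 * Gam 2) = mat_adjoint (Pi_mat 2) * R * Pi_mat 1 * J 1"
    by (simp only: assoc_mult_mat[OF S P(1) Jc(1)])
  have "mat_adjoint (Pi_mat 2) * R * Pi_mat 1 = mat_adjoint (Pi_mat 2) * Gam 1"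
    unfolding Gam_def by (rule assoc_mult_mat[OF mat_adjoint_carrier[OF P(2)] R_carrier P(1)])
  then show "J 2 * (mat_adjoint (Pi_mat 2) * R * Pi_mat 1) = Pi_hat 2 * Gam 1"
    using assoc_mult_mat[OF Jc(2) mat_adjoint_carrier[OF P(2)] Gam_carrier[of 1]] by (simp add: H)
qed

lemma G21_eq:
  "G21 = - (J 2 * (mat_adjoint G12 - \<i> \<cdot>\<^sub>m four_block_mat
      (L1 * mat_adjoint L2) (0\<^sub>m (m1 * m3) (m2 * m3))
      (0\<^sub>m (m1 * m3) (m2 * m3)) (- (L1 * mat_adjoint L2))) * J 1)"
proof -
  let ?a = "m1 * m3" and ?b = "m2 * m3"
  let ?M = "\<lambda>X. J 2 * X * J 1"
  let ?O = "0\<^sub>m ?a ?b :: complex mat"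
  define LL where "LL = L1 * mat_adjoint L2"
  have Lc: "L1 \<in> carrier_mat ?a m3" "L2 \<in> carrier_mat ?b m3"
    by (auto simp: L1_def L2_def kron_def ones_def)
  then have LL: "LL \<in> carrier_mat ?a ?b" and LL_adj: "mat_adjoint (L2 * mat_adjoint L1) = LL"
    by (simp_all add: LL_def mat_adjoint_mult[OF Lc(2) mat_adjoint_carrier[OF Lc(1)]])
  have K: "K12 \<in> carrier_mat ?b ?a" "K11 \<in> carrier_mat ?a ?b"
    unfolding K12_def K11_def block_row_def block_col_def
    using block_mat_carrier[of 1 m1 ?b m3] block_mat_carrier[of m1 1 m3 ?b] by simp_all
  \<comment> \<open>The part that the two off-diagonal blocks have in common.\<close>
  define S where "S = mat_adjoint (Pi_mat 2) * R * Pi_mat 1"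
  have Jc: "J 1 \<in> carrier_mat (?b + ?b) (?b + ?b)" "J 2 \<in> carrier_mat (?a + ?a) (?a + ?a)"
    using J_carrier[of 1] J_carrier[of 2] by simp_all
  have S: "S \<in> carrier_mat (?a + ?a) (?b + ?b)"
    unfolding S_def using Pi_mat_carrier[of 1] Pi_mat_carrier[of 2]
    by (intro mult_carrier_mat[of _ _ m] mat_adjoint_carrier R_carrier) simp_all
  have PG: "Pi_hat 1 * Gam 2 \<in> carrier_mat (?b + ?b) (?a + ?a)"
    using mat_adjoint_carrier[OF mult_carrier_mat[OF S Jc(1)]]
    by (metis Pi_hat_Gam(1) S_def mat_adjoint_adjoint)
  define N where "N = four_block_mat (L2 * mat_adjoint L1) (0\<^sub>m ?b ?a) K12 (0\<^sub>m ?b ?a)"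
  have L21: "L2 * mat_adjoint L1 \<in> carrier_mat ?b ?a" using Lc by auto
  have N: "N \<in> carrier_mat (?b + ?b) (?a + ?a)" unfolding N_def using L21 by simp
  have N_adj: "mat_adjoint N = four_block_mat LL K11 ?O ?O"
    unfolding N_def using L21 K
    by (simp add: mat_adjoint_four_block_mat[of _ ?b ?a _ ?a _ ?b] LL_adj K12_adjoint)
  define D where "D = four_block_mat LL ?O ?O (- LL)"
  have D: "D \<in> carrier_mat (?a + ?a) (?b + ?b)" unfolding D_def using LL by simp
  \<comment> \<open>\<open>E\<close> is the correction term of \<open>mat_adjoint G12\<close> with \<open>L1 L2*\<close> moved from the upper left
    to the lower right corner, which is the effect of subtracting \<open>D\<close>.\<close>
  define E where "E = four_block_mat ?O K11 ?O LL"
  have E: "E \<in> carrier_mat (?a + ?a) (?b + ?b)" unfolding E_def using LL by simp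
  have SJ: "S * J 1 \<in> carrier_mat (?a + ?a) (?b + ?b)" using S Jc by auto
  have "mat_adjoint G12 - \<i> \<cdot>\<^sub>m D = (- \<i>) \<cdot>\<^sub>m (S * J 1 - mat_adjoint N) - \<i> \<cdot>\<^sub>m D"
    unfolding G12_def N_def[symmetric]
    by (simp add: mat_adjoint_smult mat_adjoint_minus[OF PG N] Pi_hat_Gam(1) S_def del: One_nat_def)
  also have "\<dots> = (- \<i>) \<cdot>\<^sub>m (S * J 1 - E)"
  proof (rule eq_matI)
    fix i j assume "i < dim_row ((- \<i>) \<cdot>\<^sub>m (S * J 1 - E))" "j < dim_col ((- \<i>) \<cdot>\<^sub>m (S * J 1 - E))"
    then have ij: "i < ?a + ?a" "j < ?b + ?b" using E by auto
    have "mat_adjoint N $$ (i, j) - D $$ (i, j) = E $$ (i, j)"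
      using ij LL K by (auto simp: N_adj D_def E_def)
    moreover have "i < dim_col N" "j < dim_row N" using ij N by auto
    ultimately show "((- \<i>) \<cdot>\<^sub>m (S * J 1 - mat_adjoint N) - \<i> \<cdot>\<^sub>m D) $$ (i, j)
        = ((- \<i>) \<cdot>\<^sub>m (S * J 1 - E)) $$ (i, j)"
      using ij D E SJ mat_adjoint_carrier[OF N]
      by (simp add: algebra_simps del: index_mult_mat(1) index_mat_adjoint flip: distrib_left)
  qed (use D E SJ N in auto)
  finally have "mat_adjoint G12 - \<i> \<cdot>\<^sub>m D = (- \<i>) \<cdot>\<^sub>m (S * J 1 - E)" .
  then have "?M (mat_adjoint G12 - \<i> \<cdot>\<^sub>m D) = J 2 * ((- \<i>) \<cdot>\<^sub>m (S * J 1 - E)) * J 1" by simp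
  also have "J 2 * ((- \<i>) \<cdot>\<^sub>m (S * J 1 - E)) = (- \<i>) \<cdot>\<^sub>m (J 2 * (S * J 1 - E))"
    by (rule mult_smult_distrib[OF Jc(2) minus_carrier_mat[OF E]])
  also have "\<dots> * J 1 = (- \<i>) \<cdot>\<^sub>m ?M (S * J 1 - E)"
    by (rule mult_smult_assoc_mat[OF mult_carrier_mat[OF Jc(2) minus_carrier_mat[OF E]] Jc(1)])
  also have "J 2 * (S * J 1 - E) = J 2 * (S * J 1) - J 2 * E"
    by (rule mult_minus_distrib_mat[OF Jc(2) SJ E])
  also have "\<dots> * J 1 = ?M (S * J 1) - ?M E"
    by (rule minus_mult_distrib_mat[OF mult_carrier_mat[OF Jc(2) SJ] mult_carrier_mat[OF Jc(2) E] Jc(1)])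
  also have "?M (S * J 1) = J 2 * S"
  proof -
    have "?M (S * J 1) = J 2 * S * J 1 * J 1"
      using assoc_mult_mat[OF Jc(2) S Jc(1)] by simp
    also have "\<dots> = J 2 * S * (J 1 * J 1)"
      by (rule assoc_mult_mat[OF mult_carrier_mat[OF Jc(2) S] Jc(1) Jc(1)])
    finally show ?thesis using J_square[of 1] right_mult_one_mat[OF mult_carrier_mat[OF Jc(2) S]] by simp
  qed
  also have "J 2 * S = Pi_hat 2 * Gam 1" unfolding S_def by (rule Pi_hat_Gam(2))
  also have "?M E = four_block_mat LL ?O K11 ?O"
    using LL K unfolding J_def E_def by (simp add: exchange_four_block_exchange)
  finally have M: "?M (mat_adjoint G12 - \<i> \<cdot>\<^sub>m D)
      = (- \<i>) \<cdot>\<^sub>m (Pi_hat 2 * Gam 1 - four_block_mat LL ?O K11 ?O)" .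
  have "G21 = - ?M (mat_adjoint G12 - \<i> \<cdot>\<^sub>m D)"
    unfolding M G21_def LL_def[symmetric] by (rule eq_matI) simp_all
  then show ?thesis unfolding D_def LL_def .
qed

end


theorem theorem4p3:
  fixes m1 m2 m3 :: nat and t :: "int \<Rightarrow> int \<Rightarrow> complex mat" and T :: "complex mat"
  assumes "m1 \<ge> 2" and "m2 \<ge> 2" and "m3 \<ge> 2"
    and "\<And>r s. \<bar>r\<bar> < int m1 \<Longrightarrow> \<bar>s\<bar> < int m2 \<Longrightarrow> t r s \<in> carrier_mat m3 m3"
    and "T = block_tbt.T m1 m2 m3 t"
    and "invertible_mat T"
    and "T = mat_adjoint T"
  shows "(\<forall>p\<in>{1, 2}. \<forall>\<mu>1 \<mu>2. \<mu>1 \<noteq> - \<i> / 2 \<longrightarrow> \<mu>2 \<noteq> - \<i> / 2 \<longrightarrow>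
            block_tbt.u m1 m2 m3 t p (\<mu>1, \<mu>2) =
              mat_adjoint (block_tbt.u_hat m1 m2 m3 t p (cnj \<mu>1, cnj \<mu>2)) * block_tbt.J m1 m2 m3 p)
       \<and> block_tbt.G21 m1 m2 m3 t =
           - (block_tbt.J m1 m2 m3 2
              * (mat_adjoint (block_tbt.G12 m1 m2 m3 t)
                 - \<i> \<cdot>\<^sub>m four_block_mat
                     (block_tbt.L1 m1 m3 * mat_adjoint (block_tbt.L2 m2 m3))
                     (0\<^sub>m (m1 * m3) (m2 * m3))
                     (0\<^sub>m (m1 * m3) (m2 * m3))
                     (- (block_tbt.L1 m1 m3 * mat_adjoint (block_tbt.L2 m2 m3))))
              * block_tbt.J m1 m2 m3 1)"
proof -
  interpret self_adjoint_block_tbt m1 m2 m3 t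
    using assms(4-7) by unfold_locales simp_all
  show ?thesis using u_eq_u_hat_adjoint G21_eq by simp
qed

end
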